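(* Let $f:\mathbb{R}^n\to\mathbb{R}^n$ be a function, $F:\mathbb{R}^n\rightrightarrows\mathbb{R}^n$ a set-valued map and $p:[0,1]\to\mathbb{R}^n$ a function. For $t\in[0,1]$ let $G_t(v)=f(v)-p(t)+F(v)$ and $S(t)=\{z\in\mathbb{R}^n : 0\in G_t(z)\}$. Assume that (i) $z:[0,1]\to\mathbb{R}^n$ is a solution trajectory, i.e. $z(t)\in S(t)$ for all $t\in[0,1]$, which is isolated from other trajectories, i.e. there is an open set $\mathcal{O}\subset\mathbb{R}^{n+1}$ such that $$\{(t,v) : t\in[0,1]\ \text{and}\ 0\in G_t(v)\}\cap\mathcal{O}=\operatorname{gph} z;$$ (ii) $p$ is continuous; (iii) for every $t\in[0,1]$, $G_t$ is strongly metrically regular at $z(t)$ for $0$. Then $z$ is a continuous function.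
   Context: For a set-valued map $H:\mathbb{R}^n\rightrightarrows\mathbb{R}^n$, $H^{-1}(y)=\{x: y\in H(x)\}$. $\mathbb{B}_r(x)$ denotes the closed ball of radius $r$ centred at $x$. $\operatorname{gph} z=\{(t,z(t)) : t\in[0,1]\}$. $G_t$ is strongly metrically regular at $z(t)$ for $0$ if $0\in G_t(z(t))$ and there exist constants $a_t,b_t,\kappa_t>0$ such that the mapping $\mathbb{B}_{b_t}(0)\ni y\mapsto G_t^{-1}(y)\cap\mathbb{B}_{a_t}(z(t))$ is single-valued (exactly one value for each $y$) and Lipschitz continuous with Lipschitz constant $\kappa_t$. *)

theory Defs
  imports "HOL-Analysis.Analysis"
begin

(* A set-valued map from R^n to R^n is a function into sets; empty values are allowed. *)

definition setvalued_inverse :: "('a \<Rightarrow> 'b set) \<Rightarrow> 'b \<Rightarrow> 'a set" where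
  "setvalued_inverse H y = {x. y \<in> H x}"

(* s is the function whose singleton values make up the localized inverse. *)
definition strongly_metrically_regular ::
  "('a::metric_space \<Rightarrow> 'b::metric_space set) \<Rightarrow> 'a \<Rightarrow> 'b \<Rightarrow> bool" where
  "strongly_metrically_regular H x y \<longleftrightarrow>
     y \<in> H x \<and>
     (\<exists>a b \<kappa>. a > 0 \<and> b > 0 \<and> \<kappa> > 0 \<and>
       (\<exists>s. (\<forall>w \<in> cball y b. setvalued_inverse H w \<inter> cball x a = {s w}) \<and>
            \<kappa>-lipschitz_on (cball y b) s))"

definition G_map ::
  "('a::real_normed_vector \<Rightarrow> 'a) \<Rightarrow> ('a \<Rightarrow> 'a set) \<Rightarrow> (real \<Rightarrow> 'a) \<Rightarrow> real \<Rightarrow> 'a \<Rightarrow> 'a set" where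
  "G_map f F p t v = {f v - p t + w | w. w \<in> F v}"

definition solution_map ::
  "('a::real_normed_vector \<Rightarrow> 'a) \<Rightarrow> ('a \<Rightarrow> 'a set) \<Rightarrow> (real \<Rightarrow> 'a) \<Rightarrow> real \<Rightarrow> 'a set" where
  "solution_map f F p t = {v. 0 \<in> G_map f F p t v}"

(* Functions on [0,1] are total functions whose values outside [0,1] are never used. *)
definition gph :: "(real \<Rightarrow> 'a) \<Rightarrow> (real \<times> 'a) set" where
  "gph z = {(t, z t) | t. t \<in> {0..1}}"

definition solution_trajectory ::
  "('a::real_normed_vector \<Rightarrow> 'a) \<Rightarrow> ('a \<Rightarrow> 'a set) \<Rightarrow> (real \<Rightarrow> 'a) \<Rightarrow> (real \<Rightarrow> 'a) \<Rightarrow> bool" where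
  "solution_trajectory f F p z \<longleftrightarrow> (\<forall>t \<in> {0..1}. z t \<in> solution_map f F p t)"

(* R^(n+1) is rendered as the product of R and R^n, which carries the same topology. *)
definition isolated_trajectory ::
  "('a::real_normed_vector \<Rightarrow> 'a) \<Rightarrow> ('a \<Rightarrow> 'a set) \<Rightarrow> (real \<Rightarrow> 'a) \<Rightarrow> (real \<Rightarrow> 'a) \<Rightarrow> bool" where
  "isolated_trajectory f F p z \<longleftrightarrow>
     (\<exists>U :: (real \<times> 'a) set. open U \<and>
        {(t, v). t \<in> {0..1} \<and> 0 \<in> G_map f F p t v} \<inter> U = gph z)"

end

(* If s is the localized inverse of G_t, then s (p r - p t) solves the inclusion at time r and tends
   to s 0 = z t as r tends to t. So for r close to t the point (r, s (p r - p t)) lies in the open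
   set isolating the graph of z, which forces z r = s (p r - p t). *)
theory Submission
  imports Defs
begin

text \<open>Time enters \<open>G_map\<close> only through the additive term \<open>- p t\<close>, so
  a change of time is a shift of the target value. Regularity at the single time \<open>t\<close>
  thus yields solutions at nearby times.\<close>

lemma zero_in_G_map_iff:
  "0 \<in> G_map f F p r v \<longleftrightarrow> p r - p t \<in> G_map f F p t v"
proof -
  have "0 = f v - p r + w \<longleftrightarrow> p r - p t = f v - p t + w" for w
    by (auto simp: algebra_simps)
  then show ?thesis
    by (simp add: G_map_def)
qed

theorem proposition4p2p4:
  fixes f :: "real ^ 'n \<Rightarrow> real ^ 'n"
    and F :: "real ^ 'n \<Rightarrow> (real ^ 'n) set"
    and p z :: "real \<Rightarrow> real ^ 'n"
  assumes "solution_trajectory f F p z"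
    and "isolated_trajectory f F p z"
    and "continuous_on {0..1} p"
    and "\<And>t. t \<in> {0..1} \<Longrightarrow> strongly_metrically_regular (G_map f F p t) (z t) 0"
  shows "continuous_on {0..1} z"
  unfolding continuous_on_def
proof
  fix t :: real
  assume t: "t \<in> {0..1}"
  let ?N = "at t within {0..1}"
  obtain U where U: "open U"
    and iso: "{(t, v). t \<in> {0..1} \<and> 0 \<in> G_map f F p t v} \<inter> U = gph z"
    using assms(2) by (auto simp: isolated_trajectory_def)
  obtain a b \<kappa> s where "a > 0" "b > 0" and zt: "0 \<in> G_map f F p t (z t)"
    and s: "\<And>w. w \<in> cball 0 b \<Longrightarrow>
      setvalued_inverse (G_map f F p t) w \<inter> cball (z t) a = {s w}"
    and lip: "\<kappa>-lipschitz_on (cball 0 b) s"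
    using assms(4)[OF t] by (auto simp: strongly_metrically_regular_def)
  \<comment> \<open>\<open>z t\<close> lies in the localized inverse at 0, which is the singleton of
    \<open>s 0\<close>.\<close>
  have s0: "s 0 = z t"
  proof -
    have "z t \<in> setvalued_inverse (G_map f F p t) 0 \<inter> cball (z t) a"
      using zt \<open>a > 0\<close> by (simp add: setvalued_inverse_def)
    then show ?thesis
      using s[of 0] \<open>b > 0\<close> by simp
  qed
  have p_lim: "((\<lambda>r. p r - p t) \<longlongrightarrow> 0) ?N"
    using LIM_zero[OF assms(3)[unfolded continuous_on_def, rule_format, OF t]] .
  \<comment> \<open>The properties of \<open>s\<close> hold only on \<open>cball 0 b\<close>, so its
    argument must stay there.\<close>
  have near: "\<forall>\<^sub>F r in ?N. p r - p t \<in> cball 0 b"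
    using tendstoD[OF p_lim \<open>b > 0\<close>] by eventually_elim simp
  have s_lim: "((\<lambda>r. s (p r - p t)) \<longlongrightarrow> z t) ?N"
    using continuous_on_tendsto_compose[OF lipschitz_on_continuous_on[OF lip] p_lim _ near]
      \<open>b > 0\<close> by (simp add: s0)
  have "(t, z t) \<in> U"
    using iso t unfolding gph_def by blast
  then have "\<forall>\<^sub>F r in ?N. (r, s (p r - p t)) \<in> U"
    using topological_tendstoD[OF tendsto_Pair[OF tendsto_ident_at s_lim] U] by simp
  \<comment> \<open>\<open>iso\<close> describes solutions only for times in [0,1].\<close>
  moreover have "\<forall>\<^sub>F r in ?N. r \<in> {0..1}"
    by (simp add: eventually_at_filter)
  ultimately have "\<forall>\<^sub>F r in ?N. s (p r - p t) = z r"
    using near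
  proof eventually_elim
    case (elim r)
    have "s (p r - p t) \<in> setvalued_inverse (G_map f F p t) (p r - p t)"
      using s[OF elim(3)] by blast
    then have "0 \<in> G_map f F p r (s (p r - p t))"
      unfolding zero_in_G_map_iff[of f F p r _ t] by (simp add: setvalued_inverse_def)
    \<comment> \<open>It is not known yet that \<open>z r\<close> is in
      \<open>cball (z t) a\<close>, so uniqueness in that ball cannot identify it with
      \<open>s (p r - p t)\<close>. Isolation can: the graph of \<open>z\<close> has just one point
      above \<open>r\<close>.\<close>
    then have "(r, s (p r - p t)) \<in> {(t, v). t \<in> {0..1} \<and> 0 \<in> G_map f F p t v} \<inter> U"
      using elim(1,2) by simp
    then show ?case
      unfolding iso by (auto simp: gph_def)
  qed
  then show "(z \<longlongrightarrow> z t) ?N"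
    by (rule Lim_transform_eventually[OF s_lim])
qed

end
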